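(* Let $\mathcal{I}$ be an analytic tall ideal on $\omega$. Then there exists an $F_\sigma$ tall ideal $\mathcal{J}$ on $\omega$ with $\mathcal{J} \subseteq \mathcal{I}$. In particular, tall $F_\sigma$ ideals are dense among tall analytic ideals in the Katětov order, i.e., for every tall analytic ideal $\mathcal{I}$ on $\omega$ there is a tall $F_\sigma$ ideal $\mathcal{J}$ on $\omega$ that is Katětov below $\mathcal{I}$.
   Context: An ideal on $\omega$ is a collection $\mathcal{I}$ of subsets of $\omega$ such that for all $A,B\subseteq\omega$: (1) if $A,B\in\mathcal{I}$ then $A\cup B\in\mathcal{I}$; (2) if $A\in\mathcal{I}$ and $B\subseteq A$ then $B\in\mathcal{I}$; (3) every finite $A$ is in $\mathcal{I}$; (4) $\omega\notin\mathcal{I}$. Subsets of $\omega$ are identified with their characteristic functions, so an ideal is a subset of the Cantor space $2^\omega$; "analytic" and "$F_\sigma$" refer to this topology. A subset of $2^\omega$ is analytic if it is a continuous image of the Baire space $\omega^\omega$. For a set $S$, $[S]^\omega$ denotes the collection of countably infinite subsets of $S$. A family $H$ of subsets of $\omega$ is tall if for every $x\in[\omega]^\omega$ there is $y\in[x]^\omega$ with $y\in H$. An ideal $\mathcal{I}$ is Katětov below an ideal $\mathcal{J}$ if there is a function $f:\omega\to\omega$ such that $f^{-1}(A)\in\mathcal{J}$ whenever $A\in\mathcal{I}$. *)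

theory Defs
  imports "HOL-Analysis.Analysis"
begin

definition ideal_on_omega :: "nat set set \<Rightarrow> bool" where
  "ideal_on_omega \<I> \<longleftrightarrow>
     (\<forall>A B. A \<in> \<I> \<longrightarrow> B \<in> \<I> \<longrightarrow> A \<union> B \<in> \<I>) \<and>
     (\<forall>A B. A \<in> \<I> \<longrightarrow> B \<subseteq> A \<longrightarrow> B \<in> \<I>) \<and>
     (\<forall>A. finite A \<longrightarrow> A \<in> \<I>) \<and>
     UNIV \<notin> \<I>"

text \<open>
  The Cantor space is the type \<^typ>\<open>nat \<Rightarrow> bool\<close> and the Baire space the type
  \<^typ>\<open>nat \<Rightarrow> nat\<close>: the library's topology on a function type is the product topology,
  and \<^typ>\<open>bool\<close> and \<^typ>\<open>nat\<close> are discrete.  A family of sets is moved into the Cantor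
  space explicitly, since \<^typ>\<open>nat set\<close> carries no topology.
\<close>

definition char_fun :: "nat set \<Rightarrow> (nat \<Rightarrow> bool)" where
  "char_fun A = (\<lambda>n. n \<in> A)"

definition analytic_family :: "nat set set \<Rightarrow> bool" where
  "analytic_family H \<longleftrightarrow>
     (\<exists>g :: (nat \<Rightarrow> nat) \<Rightarrow> (nat \<Rightarrow> bool). continuous_on UNIV g \<and> range g = char_fun ` H)"

definition fsigma_family :: "nat set set \<Rightarrow> bool" where
  "fsigma_family H \<longleftrightarrow> fsigma (char_fun ` H)"

definition tall :: "nat set set \<Rightarrow> bool" where
  "tall H \<longleftrightarrow> (\<forall>x. infinite x \<longrightarrow> (\<exists>y. y \<subseteq> x \<and> infinite y \<and> y \<in> H))"

definition katetov_below :: "nat set set \<Rightarrow> nat set set \<Rightarrow> bool" where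
  "katetov_below \<I> \<J> \<longleftrightarrow> (\<exists>f :: nat \<Rightarrow> nat. \<forall>A \<in> \<I>. f -` A \<in> \<J>)"

end

theory Submission
  imports Defs
begin

text \<open>
  Let \<open>g\<close> map the Baire space continuously onto \<open>\<I>\<close>. A branch \<open>b\<close> witnessing \<open>g b \<in> \<I>\<close> ranges
  over a space that is not compact, but an infinite subset of \<open>g b\<close> can be chosen so sparse that it
  encodes a bound for \<open>b\<close>. The family \<open>K\<close> of all sets bounding in this way a witness for one of
  their supersets is tall, hereditary and closed: for an infinite limit the witnesses
  stay in a compact set, and a finite limit is a subset of nearby members of \<open>K\<close>. Finite unions of
  members of the compact family \<open>K \<subseteq> \<I>\<close> form the required \<open>\<sigma>\<close>-compact ideal.
\<close>

section \<open>Compactness in the Cantor space\<close>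

lemma compact_Pi_UNIV:
  fixes S :: "'a \<Rightarrow> 'b::topological_space set"
  assumes "\<And>i. compact (S i)"
  shows "compact (Pi UNIV S)"
proof -
  have "compactin (product_topology (\<lambda>i. euclidean) UNIV) (PiE UNIV S)"
    using assms by (simp add: compactin_PiE)
  then show ?thesis
    by (simp add: euclidean_product_topology PiE_UNIV_domain Pi_def)
qed

lemma compact_UNIV_cantor: "compact (UNIV :: ('a \<Rightarrow> bool) set)"
  using compact_Pi_UNIV[of "\<lambda>_. UNIV :: bool set"] by (simp add: finite_imp_compact)

lemma Hausdorff_space_euclidean: "Hausdorff_space (euclidean :: 'a::t2_space topology)"
  unfolding Hausdorff_space_def disjnt_def open_openin[symmetric]
proof (intro allI impI)
  fix x y :: 'a
  assume "x \<in> topspace euclidean \<and> y \<in> topspace euclidean \<and> x \<noteq> y"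
  then show "\<exists>U V. open U \<and> open V \<and> x \<in> U \<and> y \<in> V \<and> U \<inter> V = {}"
    using hausdorff by metis
qed

text \<open>A product of Hausdorff spaces is Hausdorff, and there compact sets are closed. This
  turns compact pieces into closed ones for the F-sigma property.\<close>

lemma compact_imp_closed_fun:
  fixes S :: "('a \<Rightarrow> 'b::t2_space) set"
  assumes "compact S"
  shows "closed S"
proof -
  have "Hausdorff_space (product_topology (\<lambda>i::'a. euclidean :: 'b topology) UNIV)"
    by (simp add: Hausdorff_space_product_topology Hausdorff_space_euclidean)
  then have "Hausdorff_space (euclidean :: ('a \<Rightarrow> 'b) topology)"
    by (simp add: euclidean_product_topology)
  then show ?thesis
    using assms compactin_imp_closedin[of euclidean S] by simp
qed

lemma continuous_on_sup_cantor:
  "continuous_on S (\<lambda>p :: ('a \<Rightarrow> bool) \<times> ('a \<Rightarrow> bool). sup (fst p) (snd p))"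
proof (rule continuous_on_coordinatewise_then_product)
  fix i
  have coord: "continuous_on UNIV (\<lambda>x :: 'a \<Rightarrow> bool. x i)"
    by simp
  \<comment> \<open>On truth values the join is \<open>max\<close>, so the continuity of
    \<open>max\<close> applies in each coordinate.\<close>
  have "continuous_on S (\<lambda>p :: ('a \<Rightarrow> bool) \<times> ('a \<Rightarrow> bool). max (fst p i) (snd p i))"
    by (intro continuous_on_max continuous_on_compose2[OF coord] continuous_intros) auto
  moreover have "sup x y i = max (x i) (y i)" for x y :: "'a \<Rightarrow> bool"
    by (auto simp: max_def)
  ultimately show "continuous_on S (\<lambda>p :: ('a \<Rightarrow> bool) \<times> ('a \<Rightarrow> bool). sup (fst p) (snd p) i)"
    by simp
qed

lemma open_cylinder:
  fixes x :: "nat \<Rightarrow> bool"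
  shows "open {y. \<forall>i<n. y i = x i}"
proof -
  have "open {y :: nat \<Rightarrow> bool. \<forall>i\<in>{..<n}. y (id i) \<in> {x i}}"
    by (rule product_topology_basis') (auto simp: open_discrete)
  then show ?thesis
    by (simp add: Ball_def)
qed

text \<open>The singleton \<open>{h l}\<close> is open, so its preimage is a neighbourhood of
  \<open>l\<close>. Applied below to single coordinates, which therefore stabilise along a
  convergent sequence.\<close>

lemma eventually_eq_limit_discrete:
  fixes h :: "'a::topological_space \<Rightarrow> 'b::discrete_topology"
  assumes "continuous_on UNIV h" and "(f \<longlongrightarrow> l) F"
  shows "\<forall>\<^sub>F i in F. h (f i) = h l"
proof -
  have "open (h -` {h l})"
    using assms(1) by (intro open_vimage open_discrete)
  from topological_tendstoD[OF assms(2) this] show ?thesis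
    by simp
qed

section \<open>The ideal generated by a compact hereditary family\<close>

text \<open>Written as an image of a product, so that compactness passes from each stage to the
  next.\<close>

primrec joins :: "'a::bounded_semilattice_sup_bot set \<Rightarrow> nat \<Rightarrow> 'a set" where
  "joins K 0 = {bot}"
| "joins K (Suc n) = (\<lambda>p. sup (fst p) (snd p)) ` (joins K n \<times> K)"

lemma compact_joins:
  fixes K :: "('a \<Rightarrow> bool) set"
  shows "compact K \<Longrightarrow> compact (joins K n)"
  by (induction n)
    (auto intro!: compact_continuous_image continuous_on_sup_cantor compact_Times)

lemma joins_SucI: "x \<in> joins K n \<Longrightarrow> y \<in> K \<Longrightarrow> sup x y \<in> joins K (Suc n)"
  by (auto intro!: image_eqI[of _ _ "(x, y)"])

lemma joins_sup:
  "x \<in> joins K m \<Longrightarrow> y \<in> joins K n \<Longrightarrow> sup x y \<in> joins K (m + n)"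
proof (induction n arbitrary: y)
  case 0
  then show ?case by simp
next
  case (Suc n)
  then obtain u v where "u \<in> joins K n" "v \<in> K" "y = sup u v" by auto
  with Suc joins_SucI[of "sup x u" K "m + n" v] show ?case
    by (simp add: sup_assoc)
qed

text \<open>By distributivity, an element below \<open>sup u v\<close> is the join of its meets with
  \<open>u\<close> and with \<open>v\<close>.\<close>

lemma joins_hereditary:
  fixes K :: "'a::{distrib_lattice,bounded_semilattice_sup_bot} set"
  assumes hered: "\<And>x y. x \<in> K \<Longrightarrow> y \<le> x \<Longrightarrow> y \<in> K"
  shows "x \<in> joins K n \<Longrightarrow> y \<le> x \<Longrightarrow> y \<in> joins K n"
proof (induction n arbitrary: x y)
  case 0
  then show ?case by (simp add: bot_unique)
next
  case (Suc n)
  then obtain u v where uv: "u \<in> joins K n" "v \<in> K" "x = sup u v" by auto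
  have "inf u y \<in> joins K n" "inf v y \<in> K"
    using Suc.IH[OF uv(1)] hered[OF uv(2)] by simp_all
  then have "sup (inf u y) (inf v y) \<in> joins K (Suc n)"
    by (rule joins_SucI)
  moreover have "sup (inf u y) (inf v y) = y"
    using Suc.prems(2) uv(3) by (simp add: inf_sup_distrib2[symmetric] inf_absorb2)
  ultimately show ?case by simp
qed

lemma char_fun_eq_iff: "char_fun A = char_fun B \<longleftrightarrow> A = B"
  by (auto simp: char_fun_def fun_eq_iff)

lemma char_fun_le_iff: "char_fun A \<le> char_fun B \<longleftrightarrow> A \<subseteq> B"
  by (auto simp: char_fun_def le_fun_def)

lemma char_fun_Un: "char_fun (A \<union> B) = sup (char_fun A) (char_fun B)"
  by (auto simp: char_fun_def fun_eq_iff)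

lemma char_fun_Collect: "char_fun {n. x n} = x"
  by (simp add: char_fun_def)

text \<open>Take for \<open>\<J>\<close> all finite unions of sets from \<open>K\<close>: a
  countable union of the compact stages \<open>joins K n\<close>. The singletons bring in all finite
  sets, and \<open>\<J>\<close> is proper because it lies inside \<open>\<I>\<close>.\<close>

lemma fsigma_subideal_of_compact:
  assumes "compact K"
    and hered: "\<And>x y. x \<in> K \<Longrightarrow> y \<le> x \<Longrightarrow> y \<in> K"
    and sing: "\<And>n. char_fun {n} \<in> K"
    and \<I>: "ideal_on_omega \<I>"
    and K_sub: "K \<subseteq> char_fun ` \<I>"
  obtains \<J> where "ideal_on_omega \<J>" "fsigma_family \<J>" "\<J> \<subseteq> \<I>" "K \<subseteq> char_fun ` \<J>"
proof
  define \<J> where "\<J> = {A. \<exists>n. char_fun A \<in> joins K n}"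
  have mem_iff: "char_fun A \<in> char_fun ` \<I> \<longleftrightarrow> A \<in> \<I>" for A
    by (auto simp: char_fun_eq_iff image_iff)
  have bot: "bot = char_fun {}"
    by (auto simp: char_fun_def)
  have joins_sub: "joins K n \<subseteq> char_fun ` \<I>" for n
  proof (induction n)
    case 0
    have "{} \<in> \<I>"
      using \<I> by (simp add: ideal_on_omega_def)
    then show ?case by (simp add: bot)
  next
    case (Suc n)
    have "sup x y \<in> char_fun ` \<I>" if xy: "x \<in> joins K n" "y \<in> K" for x y
    proof -
      obtain A B where "A \<in> \<I>" "B \<in> \<I>" "x = char_fun A" "y = char_fun B"
        using xy Suc K_sub by blast
      then show ?thesis
        using \<I> by (auto simp: ideal_on_omega_def simp flip: char_fun_Un)
    qed
    then show ?case by auto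
  qed
  then show "\<J> \<subseteq> \<I>"
    using mem_iff by (force simp: \<J>_def)
  show "K \<subseteq> char_fun ` \<J>"
  proof
    fix x assume "x \<in> K"
    then have "x \<in> joins K (Suc 0)"
      using joins_SucI[of bot K 0 x] by simp
    then have "{n. x n} \<in> \<J>"
      unfolding \<J>_def mem_Collect_eq char_fun_Collect by blast
    then show "x \<in> char_fun ` \<J>"
      by (metis char_fun_Collect imageI)
  qed
  have "char_fun ` \<J> = (\<Union>n. joins K n)"
  proof (intro set_eqI iffI)
    fix x assume "x \<in> (\<Union>n. joins K n)"
    then have "{n. x n} \<in> \<J>"
      by (simp add: \<J>_def char_fun_Collect)
    then show "x \<in> char_fun ` \<J>"
      by (metis char_fun_Collect imageI)
  qed (auto simp: \<J>_def)
  moreover have "fsigma (\<Union>n. joins K n)"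
    by (intro fsigma.intros compact_imp_closed_fun compact_joins assms(1))
  ultimately show "fsigma_family \<J>"
    unfolding fsigma_family_def by simp
  have Un: "A \<union> B \<in> \<J>" if "A \<in> \<J>" "B \<in> \<J>" for A B
    using that unfolding \<J>_def mem_Collect_eq char_fun_Un by (blast intro: joins_sup)
  have "A \<in> \<J>" if "finite A" for A
    using that
  proof (induction A)
    case empty
    have "char_fun {} \<in> joins K 0" by (simp add: bot)
    then show ?case unfolding \<J>_def by blast
  next
    case (insert a A)
    have "char_fun {a} \<in> joins K (Suc 0)"
      using joins_SucI[of bot K 0 "char_fun {a}"] sing by simp
    then have "{a} \<in> \<J>"
      unfolding \<J>_def by blast
    then show ?case
      using Un[of "{a}" A] insert by simp
  qed
  moreover have "B \<in> \<J>" if "A \<in> \<J>" "B \<subseteq> A" for A B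
    using that joins_hereditary[of K "char_fun A" _ "char_fun B"] hered
    unfolding \<J>_def mem_Collect_eq char_fun_le_iff[symmetric] by blast
  moreover have "UNIV \<notin> \<J>"
    using \<open>\<J> \<subseteq> \<I>\<close> \<I> by (auto simp: ideal_on_omega_def)
  ultimately show "ideal_on_omega \<J>"
    using Un by (auto simp: ideal_on_omega_def)
qed

section \<open>Sets that bound a witness of membership\<close>

text \<open>If \<open>x\<close> is infinite, any two of its elements \<open>k < m\<close> with
  \<open>j \<le> k\<close> cap \<open>b j\<close>, so \<open>x\<close> alone confines all such
  \<open>b\<close> to a compact box.\<close>

definition bounds_seq :: "(nat \<Rightarrow> bool) \<Rightarrow> (nat \<Rightarrow> nat) \<Rightarrow> bool" where
  "bounds_seq x b \<longleftrightarrow> (\<forall>k m. x k \<longrightarrow> x m \<longrightarrow> k < m \<longrightarrow> (\<forall>j\<le>k. b j \<le> m))"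

text \<open>The inequality \<open>x \<le> g b\<close>, in place of equality, makes the family
  hereditary and admits sparse subsets of \<open>g b\<close>.\<close>

definition bounded_witness :: "((nat \<Rightarrow> nat) \<Rightarrow> nat \<Rightarrow> bool) \<Rightarrow> (nat \<Rightarrow> bool) set" where
  "bounded_witness g = {x. \<exists>b. x \<le> g b \<and> bounds_seq x b}"

lemma bounded_witness_hereditary:
  "x \<in> bounded_witness g \<Longrightarrow> y \<le> x \<Longrightarrow> y \<in> bounded_witness g"
proof -
  assume "x \<in> bounded_witness g" and le: "y \<le> x"
  then obtain b where b: "x \<le> g b" "bounds_seq x b"
    unfolding bounded_witness_def by blast
  have "bounds_seq y b"
    using b(2) predicate1D[OF le] unfolding bounds_seq_def by blast
  moreover have "y \<le> g b"
    using le b(1) by (rule order_trans)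
  ultimately show ?thesis
    unfolding bounded_witness_def by blast
qed

lemma exists_sparse_subset:
  assumes "infinite A"
  obtains B where "B \<subseteq> A" "infinite B" "bounds_seq (char_fun B) b"
proof -
  have next_elem: "\<exists>m. m \<in> A \<and> k < m \<and> (\<forall>j\<le>k. b j \<le> m)" for k
  proof -
    \<comment> \<open>The sum exceeds both \<open>k\<close> and every \<open>b j\<close> with
      \<open>j \<le> k\<close>.\<close>
    obtain m where "m \<in> A" "m > k + Max (b ` {..k})"
      using assms by (meson infinite_nat_iff_unbounded)
    moreover have "b j \<le> Max (b ` {..k})" if "j \<le> k" for j
      using that by (intro Max_ge) auto
    ultimately have "m \<in> A \<and> k < m \<and> (\<forall>j\<le>k. b j \<le> m)"
      by (meson add_leD1 add_leD2 le_less_trans less_imp_le le_add1 order_trans)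
    then show ?thesis ..
  qed
  have "\<exists>s. \<forall>n::nat. s n \<in> A \<and> (s n < s (Suc n) \<and> (\<forall>j\<le>s n. b j \<le> s (Suc n)))"
    by (rule dependent_nat_choice) (use next_elem in blast)+
  then obtain s where s: "\<And>n::nat. s n \<in> A" "\<And>n. s n < s (Suc n)"
      "\<And>n j. j \<le> s n \<Longrightarrow> b j \<le> s (Suc n)"
    by blast
  then have mono: "strict_mono s"
    by (simp add: strict_mono_Suc_iff)
  have "bounds_seq (char_fun (range s)) b"
    unfolding bounds_seq_def
  proof (intro allI impI)
    fix k m j
    assume "char_fun (range s) k" "char_fun (range s) m" "k < m" "j \<le> k"
    then obtain p q where "k = s p" "m = s q"
      by (auto simp: char_fun_def)
    with \<open>k < m\<close> mono have "Suc p \<le> q"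
      by (simp add: strict_mono_less Suc_le_eq)
    \<comment> \<open>Control of consecutive elements suffices, since every later element is at
      least the successor.\<close>
    then have "s (Suc p) \<le> m"
      using mono \<open>m = s q\<close> by (simp add: strict_mono_less_eq)
    then show "b j \<le> m"
      using s(3)[of j p] \<open>j \<le> k\<close> \<open>k = s p\<close> by simp
  qed
  moreover have "infinite (range s)"
    using mono by (simp add: range_inj_infinite strict_mono_imp_inj_on)
  moreover have "range s \<subseteq> A"
    using s(1) by blast
  ultimately show ?thesis
    using that by blast
qed

text \<open>Two elements of \<open>x\<close> beyond \<open>j\<close> lie in almost all
  \<open>y n\<close> and bound \<open>b n j\<close> there. The witnesses thus stay in a compact box,
  and the limit of a subsequence is a witness for \<open>x\<close>.\<close>

lemma infinite_limit_bounded_witness: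
  fixes g :: "(nat \<Rightarrow> nat) \<Rightarrow> nat \<Rightarrow> bool"
  assumes cont: "continuous_on UNIV g"
    and inf: "infinite {n. x n}"
    and y: "\<And>n. y n \<in> bounded_witness g"
    and lim: "\<And>n i. i < n \<Longrightarrow> y n i = x i"
  shows "x \<in> bounded_witness g"
proof -
  obtain b where b: "\<And>n. y n \<le> g (b n)" "\<And>n. bounds_seq (y n) (b n)"
    using y unfolding bounded_witness_def by simp metis
  have "\<exists>M. \<forall>n. b n j \<le> M" for j
  proof -
    obtain k where k: "x k" "j < k"
      using inf by (auto simp: infinite_nat_iff_unbounded)
    obtain m where m: "x m" "k < m"
      using inf by (auto simp: infinite_nat_iff_unbounded)
    \<comment> \<open>For \<open>n > m\<close> the set \<open>y n\<close> contains both
      \<open>k\<close> and \<open>m\<close>, so \<open>m\<close> is a bound; the finitely many other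
      indices are absorbed by \<open>Max\<close>.\<close>
    have "b n j \<le> max m (Max ((\<lambda>n. b n j) ` {..m}))" for n
    proof (cases "n \<le> m")
      case True
      then show ?thesis
        by (intro max.coboundedI2 Max_ge) auto
    next
      case False
      then have "y n k" "y n m"
        using lim k m by simp_all
      then show ?thesis
        using b(2)[of n] k m unfolding bounds_seq_def by (simp add: max.coboundedI1)
    qed
    then show ?thesis by blast
  qed
  then obtain M where M: "\<And>n j. b n j \<le> M j"
    by metis
  have "seq_compact (Pi UNIV (\<lambda>j. {..M j}))"
    by (intro compact_imp_seq_compact compact_Pi_UNIV finite_imp_compact) simp
  then obtain l r where r: "strict_mono r" and l: "(b \<circ> r) \<longlonglongrightarrow> l"
    using M by (auto elim!: seq_compactE[of _ b])
  \<comment> \<open>Hence \<open>y (r n)\<close> still agrees with \<open>x\<close> below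
    \<open>n\<close>.\<close>
  have le: "i \<le> r i" for i
    using r by (rule seq_suble)
  have "x \<le> g l"
  proof (rule le_funI, rule le_boolI)
    fix i assume "x i"
    have "continuous_on UNIV (\<lambda>c. g c i)"
      using cont by (rule continuous_on_product_then_coordinatewise)
    then have "\<forall>\<^sub>F n in sequentially. g (b (r n)) i = g l i"
      using eventually_eq_limit_discrete[OF _ l] by fastforce
    then obtain n where "i < n" "g (b (r n)) i = g l i"
      using eventually_happens'[OF sequentially_bot eventually_conj[OF eventually_gt_at_top[of i]]]
      by blast
    moreover have "y (r n) i"
      using lim \<open>x i\<close> \<open>i < n\<close> le[of n] by simp
    ultimately show "g l i"
      using b(1)[of "r n"] by (simp add: le_fun_def)
  qed
  moreover have "bounds_seq x l"
    unfolding bounds_seq_def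
  proof (intro allI impI)
    fix k m j assume km: "x k" "x m" "k < m" "j \<le> k"
    have "\<forall>\<^sub>F n in sequentially. b (r n) j = l j"
      using eventually_eq_limit_discrete[OF continuous_on_product_coordinates l] by simp
    \<comment> \<open>The index is late enough for \<open>b (r n)\<close> to have its limit value at
      \<open>j\<close> and for \<open>y (r n)\<close> to contain \<open>k\<close> and
      \<open>m\<close>.\<close>
    then obtain n where n: "m < n" "b (r n) j = l j"
      using eventually_happens'[OF sequentially_bot eventually_conj[OF eventually_gt_at_top[of m]]]
      by blast
    then have "y (r n) k" "y (r n) m"
      using lim km le[of n] by simp_all
    then show "l j \<le> m"
      using b(2)[of "r n"] km n(2) unfolding bounds_seq_def by metis
  qed
  ultimately show ?thesis
    unfolding bounded_witness_def by blast
qed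

text \<open>If no cylinder around \<open>x\<close> missed the family, members \<open>y n\<close>
  agreeing with \<open>x\<close> below \<open>n\<close> would put \<open>x\<close> into it.\<close>

lemma closed_bounded_witness:
  fixes g :: "(nat \<Rightarrow> nat) \<Rightarrow> nat \<Rightarrow> bool"
  assumes cont: "continuous_on UNIV g"
  shows "closed (bounded_witness g)"
proof -
  have "\<exists>n. {y. \<forall>i<n. y i = x i} \<subseteq> - bounded_witness g" if x: "x \<notin> bounded_witness g" for x
  proof (rule ccontr)
    assume "\<not> ?thesis"
    then have "\<forall>n. \<exists>y. y \<in> bounded_witness g \<and> (\<forall>i<n. y i = x i)"
      by blast
    then obtain y where y: "\<And>n. y n \<in> bounded_witness g" "\<And>n i. i < n \<Longrightarrow> y n i = x i"
      by metis
    show False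
    proof (cases "finite {n. x n}")
      case True
      \<comment> \<open>A finite \<open>x\<close> is contained in \<open>y N\<close> once
        \<open>N\<close> exceeds all its elements, and heredity applies.\<close>
      then obtain N where "\<And>n. x n \<Longrightarrow> n < N"
        by (auto simp: finite_nat_set_iff_bounded)
      then have "x \<le> y N"
        using y(2) by (auto simp: le_fun_def)
      then show False
        using bounded_witness_hereditary y(1) x by blast
    next
      case False
      then show False
        using infinite_limit_bounded_witness[of g x y, OF cont] y x by blast
    qed
  qed
  then have cyl: "\<exists>n. {y. \<forall>i<n. y i = x i} \<subseteq> - bounded_witness g"
    if "x \<in> - bounded_witness g" for x
    using that by simp
  show ?thesis
    unfolding closed_def
  proof (subst open_subopen, intro ballI)
    fix x assume "x \<in> - bounded_witness g"
    then obtain n where "{y. \<forall>i<n. y i = x i} \<subseteq> - bounded_witness g"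
      using cyl by blast
    then show "\<exists>T. open T \<and> x \<in> T \<and> T \<subseteq> - bounded_witness g"
      by (intro exI[of _ "{y. \<forall>i<n. y i = x i}"]) (simp add: open_cylinder)
  qed
qed

section \<open>A tall F-sigma ideal from the sets that bound a witness\<close>

theorem theorem0p1:
  fixes \<I> :: "nat set set"
  assumes "ideal_on_omega \<I>" and "analytic_family \<I>" and "tall \<I>"
  shows "(\<exists>\<J>. ideal_on_omega \<J> \<and> fsigma_family \<J> \<and> tall \<J> \<and> \<J> \<subseteq> \<I>) \<and>
         (\<exists>\<J>. ideal_on_omega \<J> \<and> fsigma_family \<J> \<and> tall \<J> \<and> katetov_below \<J> \<I>)"
proof -
  obtain g :: "(nat \<Rightarrow> nat) \<Rightarrow> nat \<Rightarrow> bool"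
    where cont: "continuous_on UNIV g" and g: "range g = char_fun ` \<I>"
    using assms(2) unfolding analytic_family_def by blast
  let ?K = "bounded_witness g"
  have wit: "\<exists>b. g b = char_fun A" if "A \<in> \<I>" for A
    using that g by (metis imageE imageI)
  have K_compact: "compact ?K"
    using compact_Int_closed[OF compact_UNIV_cantor closed_bounded_witness[OF cont]] by simp
  have K_sing: "char_fun {n} \<in> ?K" for n
  proof -
    have "{n} \<in> \<I>"
      using assms(1) by (simp add: ideal_on_omega_def)
    then obtain b where "g b = char_fun {n}"
      using wit by blast
    then show ?thesis
      \<comment> \<open>A singleton has no two distinct elements, so it bounds every
        sequence.\<close>
      by (auto simp: bounded_witness_def bounds_seq_def char_fun_def intro!: exI[of _ b])
  qed
  have K_sub: "?K \<subseteq> char_fun ` \<I>"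
  proof
    fix x assume "x \<in> ?K"
    then obtain b where "x \<le> g b"
      by (auto simp: bounded_witness_def)
    moreover obtain A where "A \<in> \<I>" "g b = char_fun A"
      using g by blast
    ultimately have "{n. x n} \<in> \<I>"
      using assms(1) unfolding ideal_on_omega_def by (metis char_fun_Collect char_fun_le_iff)
    then show "x \<in> char_fun ` \<I>"
      by (metis char_fun_Collect imageI)
  qed
  obtain \<J> where \<J>: "ideal_on_omega \<J>" "fsigma_family \<J>" "\<J> \<subseteq> \<I>" "?K \<subseteq> char_fun ` \<J>"
  proof (rule fsigma_subideal_of_compact[OF K_compact _ K_sing assms(1) K_sub])
    show "y \<in> ?K" if "x \<in> ?K" "y \<le> x" for x y
      using that by (rule bounded_witness_hereditary)
  qed
  have "tall \<J>"
    unfolding tall_def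
  proof (intro allI impI)
    fix X :: "nat set" assume "infinite X"
    then obtain A where A: "A \<subseteq> X" "infinite A" "A \<in> \<I>"
      using assms(3) unfolding tall_def by blast
    obtain b where b: "g b = char_fun A"
      using wit A(3) by blast
    \<comment> \<open>Thinning \<open>A\<close> along its own witness \<open>b\<close> keeps it
      below \<open>g b\<close> and makes it bound \<open>b\<close>.\<close>
    obtain B where B: "B \<subseteq> A" "infinite B" "bounds_seq (char_fun B) b"
      using exists_sparse_subset[OF A(2)] by blast
    then have "char_fun B \<in> ?K"
      unfolding bounded_witness_def mem_Collect_eq using b char_fun_le_iff by metis
    then have "B \<in> \<J>"
      using \<J>(4) by (auto simp: char_fun_eq_iff)
    then show "\<exists>Y. Y \<subseteq> X \<and> infinite Y \<and> Y \<in> \<J>"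
      using A(1) B by blast
  qed
  \<comment> \<open>By inclusion, the identity is a Katetov reduction.\<close>
  moreover have "katetov_below \<J> \<I>"
    using \<J>(3) unfolding katetov_below_def by (intro exI[of _ id]) auto
  ultimately show ?thesis
    using \<J> by blast
qed

end
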